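(* Let $X$ be a Hilbert space, let $A,B\subset X$ be closed sets and $\bar x\in A\cap B$. Suppose that $\{A,B\}$ is DIL-restrictedly regular at $\bar x$, i.e., $\hat\theta_4[A,B](\bar x)>0$, and let $0\le\sigma<\hat{\theta}_{4}[A,B](\bar x)$ with $\sigma<1$, and $0<\tau\le1$. Then, for any real $\gamma<\hat{\theta}_{4}[A,B](\bar x)$ satisfying $0<\gamma-\sigma\le\tau$ and $$c:=\tau^{-1}(1-\gamma^2+\gamma\sigma)<1,$$ any sequence $\{x_n\}_{n\ge0}$ of $(\tau,\sigma)$-alternating projections for $\{A,B\}$ with initial point $x_0$ sufficiently close to $\bar x$ converges to a point in $A\cap B$ with $R$-linear rate $c$.
   Context: Let $X$ be a real Hilbert space. $d(x,A):=\inf_{a\in A}\|x-a\|$, and $\mathbb{B}_\rho(\bar x)$ is the open ball of radius $\rho$ centred at $\bar x$. The Fréchet normal cone to $A$ at $a\in A$ is $$N_A(a):=\Big\{u\in X \;\Big|\; \limsup_{x\to a,\,x\in A\setminus\{a\}}\frac{\langle u,x-a\rangle}{\|x-a\|}\le 0\Big\}$$ (equal to $X$ if $a$ is an isolated point of $A$). The constant $\hat\theta_4$ is defined by $$\hat{\theta}_{4}[A,B](\bar x):=\lim_{\rho\downarrow 0}\ \inf_{\substack{a\in(A\setminus B)\cap \mathbb{B}_{\rho}(\bar x)\\ b\in(B\setminus A)\cap \mathbb{B}_{\rho}(\bar x)}}\max\Big\{d\Big(\tfrac{b-a}{\|a-b\|}, N_{A}(a)\Big),\ d\Big(\tfrac{a-b}{\|a-b\|},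 N_{B}(b)\Big)\Big\},$$ with $\inf\emptyset=+\infty$. The collection $\{A,B\}$ is called DIL-restrictedly regular at $\bar x\in A\cap B$ if $\hat\theta_4[A,B](\bar x)>0$. For $\tau\in(0,1]$ and $\sigma\in[0,1)$, the $(\tau,\sigma)$-projection of $x\in X$ on $A$ is the set $$P_{A}^{\tau,\sigma}(x):= \{a\in A \mid \tau \|x-a\|\le d(x,A),\ d(x-a,N_A(a))\le \sigma\|x-a\|\},$$ and similarly for $B$. A sequence $\{x_n\}$ is a sequence of $(\tau,\sigma)$-alternating projections for $\{A,B\}$ if $x_{2n+1}\in P_B^{\tau,\sigma}(x_{2n})$ and $x_{2n+2}\in P_A^{\tau,\sigma}(x_{2n+1})$ for all $n=0,1,\ldots$. A sequence $\{x_n\}$ converges to $x^*$ with $R$-linear rate $c$ if there is a constant $C\ge0$ such that $\|x_n-x^*\|\le C c^n$ for all $n$.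
   Formalization: The R-linear rate c is asserted only when c > 0, which is automatic if θ̂₄ is finite; if θ̂₄ = +∞ and c ≤ 0, where the rate bound can fail, only convergence to a point of A∩B is asserted. *)

theory Defs
  imports "HOL-Analysis.Analysis"
begin

(* The Limsup is taken in the extended reals.  At an isolated point a the filter at a within A
   is bot, so the Limsup is -\<infinity> and the cone is the whole space. *)
definition frechet_normal_cone :: "'a::real_inner set \<Rightarrow> 'a \<Rightarrow> 'a set" where
  "frechet_normal_cone A a =
     {u. Limsup (at a within A) (\<lambda>x. ereal ((u \<bullet> (x - a)) / norm (x - a))) \<le> 0}"

lemma frechet_normal_cone_isolated:
  assumes "\<not> a islimpt A"
  shows "frechet_normal_cone A a = UNIV"
proof -
  have "at a within A = bot"
    using assms by (simp add: trivial_limit_within)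
  then show ?thesis
    by (auto simp: frechet_normal_cone_def intro: Limsup_bounded)
qed

lemma zero_in_frechet_normal_cone: "0 \<in> frechet_normal_cone A a"
  by (auto simp: frechet_normal_cone_def zero_ereal_def[symmetric] intro: Limsup_bounded)

(* The infimum is taken in the extended reals, where the infimum of the empty set is \<infinity>. *)
definition theta4_local :: "'a::real_inner set \<Rightarrow> 'a set \<Rightarrow> 'a \<Rightarrow> real \<Rightarrow> ereal" where
  "theta4_local A B xb \<rho> =
     (INF (a, b) \<in> ((A - B) \<inter> ball xb \<rho>) \<times> ((B - A) \<inter> ball xb \<rho>).
        ereal (max (infdist ((b - a) /\<^sub>R norm (a - b)) (frechet_normal_cone A a))
                   (infdist ((a - b) /\<^sub>R norm (a - b)) (frechet_normal_cone B b))))"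

definition theta4 :: "'a::real_inner set \<Rightarrow> 'a set \<Rightarrow> 'a \<Rightarrow> ereal" where
  "theta4 A B xb = Lim (at_right 0) (theta4_local A B xb)"

lemma theta4_local_antimono:
  assumes "\<rho> \<le> \<rho>'"
  shows "theta4_local A B xb \<rho>' \<le> theta4_local A B xb \<rho>"
  unfolding theta4_local_def by (rule INF_superset_mono) (use assms in auto)

(* The limit defining theta4 always exists. *)
lemma theta4_local_tendsto: "(theta4_local A B xb \<longlongrightarrow> theta4 A B xb) (at_right 0)"
proof -
  let ?s = "SUP \<rho>\<in>{0<..}. theta4_local A B xb \<rho>"
  have "(theta4_local A B xb \<longlongrightarrow> ?s) (at_right 0)"
  proof (rule order_tendstoI)
    fix l assume "l < ?s"
    then obtain \<rho> where \<rho>: "\<rho> > 0" "l < theta4_local A B xb \<rho>"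
      by (auto simp: less_SUP_iff)
    have "l < theta4_local A B xb r" if "r < \<rho>" for r
      using \<rho>(2) theta4_local_antimono[of r \<rho> A B xb] that by simp
    then show "\<forall>\<^sub>F r in at_right 0. l < theta4_local A B xb r"
      using \<rho>(1) by (auto simp: eventually_at_right_field)
  next
    fix u assume "?s < u"
    then have "theta4_local A B xb r < u" if "r > 0" for r
      using that by (meson SUP_upper greaterThan_iff le_less_trans)
    then show "\<forall>\<^sub>F r in at_right 0. theta4_local A B xb r < u"
      by (auto simp: eventually_at_right_field intro!: exI[of _ 1])
  qed
  then show ?thesis
    unfolding theta4_def by (simp add: tendsto_Lim)
qed

definition DIL_restrictedly_regular :: "'a::real_inner set \<Rightarrow> 'a set \<Rightarrow> 'a \<Rightarrow> bool" where
  "DIL_restrictedly_regular A B xb \<longleftrightarrow> theta4 A B xb > 0"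

definition inexact_proj :: "real \<Rightarrow> real \<Rightarrow> 'a::real_inner set \<Rightarrow> 'a \<Rightarrow> 'a set" where
  "inexact_proj \<tau> \<sigma> A x =
     {a \<in> A. \<tau> * norm (x - a) \<le> infdist x A \<and>
             infdist (x - a) (frechet_normal_cone A a) \<le> \<sigma> * norm (x - a)}"

(* The initial point x 0 is arbitrary: it need not lie in A. *)
definition alternating_projections ::
    "real \<Rightarrow> real \<Rightarrow> 'a::real_inner set \<Rightarrow> 'a set \<Rightarrow> (nat \<Rightarrow> 'a) \<Rightarrow> bool" where
  "alternating_projections \<tau> \<sigma> A B x \<longleftrightarrow>
     (\<forall>n. x (2 * n + 1) \<in> inexact_proj \<tau> \<sigma> B (x (2 * n)) \<and>
          x (2 * n + 2) \<in> inexact_proj \<tau> \<sigma> A (x (2 * n + 1)))"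

definition R_linear_rate :: "(nat \<Rightarrow> 'a::real_normed_vector) \<Rightarrow> 'a \<Rightarrow> real \<Rightarrow> bool" where
  "R_linear_rate x xs c \<longleftrightarrow> (\<exists>C\<ge>0. \<forall>n. norm (x n - xs) \<le> C * c ^ n)"

end

theory Submission
  imports Defs
begin

text \<open>
  Two consecutive steps of the method are compared. Let \<open>a \<in> A\<close>, let \<open>b\<close> be an inexact projection
  of \<open>a\<close> on \<open>B\<close>, let \<open>r = norm (a - b)\<close> and \<open>\<kappa> = \<gamma> - \<sigma>\<close>. The heart of the proof
  (\<open>infdist_le_of_regular_near\<close>) is the claim that \<open>d(b, A) \<le> (1 - \<gamma> \<kappa>) r\<close> when \<open>a\<close> and \<open>b\<close> are
  close to the reference point and \<open>b \<notin> A\<close>. Then the projection of \<open>b\<close> on \<open>A\<close> has distance at most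
  \<open>\<tau>\<^sup>-\<^sup>1 (1 - \<gamma> \<kappa>) r = c r\<close> from \<open>b\<close>. The roles of \<open>A\<close> and \<open>B\<close> are symmetric, so the step lengths
  decay geometrically, which gives convergence and its rate.

  The claim is proved by contradiction, with a variational argument. Minimise over \<open>A\<close> the function
  \<open>norm (x - b) + \<gamma> norm (x - a)\<close>. At a minimiser \<open>x\<close> the direction from \<open>x\<close> to \<open>b\<close> differs from a
  normal to \<open>A\<close> by at most \<open>\<gamma>\<close>, the slope of the penalty. Comparing the values at \<open>x\<close> and \<open>a\<close> gives
  \<open>\<gamma> norm (x - a) \<le> r - norm (x - b) \<le> r - d(b, A)\<close>, so that \<open>norm (x - a) < \<kappa> r\<close> if the
  claim fails. This has two consequences. First, \<open>x \<notin> B\<close>, because \<open>\<kappa> \<le> \<tau>\<close> and \<open>d(a, B) \<ge> \<tau> r\<close>.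
  Second, the unit vectors from \<open>b\<close> to \<open>x\<close> and from \<open>b\<close> to \<open>a\<close> differ by at most \<open>\<kappa>\<close>
  (\<open>direction_change_square\<close>, \<open>penalised_step_bound\<close>), so the former has distance at most
  \<open>\<sigma> + \<kappa> = \<gamma>\<close> from the normal cone of \<open>B\<close> at \<open>b\<close>. The pair \<open>x\<close>, \<open>b\<close> thus has both distances in the
  definition of \<open>theta4\<close> at most \<open>\<gamma>\<close>, against \<open>\<gamma> < theta4 A B xb\<close>.

  Two obstacles remain, and both cost an arbitrarily small error that the strict inequality absorbs.
  The penalty is not differentiable at \<open>a\<close>, and a minimum of a nonsmooth function on a nonconvex set
  yields no Frechet normal at that very point; hence the norm is replaced by
  \<open>sqrt ((norm (x - a))\<^sup>2 + \<eta>\<^sup>2)\<close>. Also, minima over closed sets need not exist in infinite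
  dimensions; \<open>quadratic_perturbation_attains_min\<close>, a smooth variational principle of Borwein-Preiss
  type, makes one exist after adding a small multiple of some \<open>(norm (x - z))\<^sup>2\<close>.
\<close>

section \<open>Sequences with geometrically decreasing steps\<close>

lemma geometric_partial_sum_le:
  fixes q :: real
  assumes "0 \<le> q" "q < 1"
  shows "(\<Sum>i<n. q ^ i) \<le> 1 / (1 - q)"
  using assms by (simp add: sum_gp_strict divide_right_mono)

text \<open>The steps have summable lengths. The argument uses only the completeness of the metric, so it
  also serves for series in a complete inner product space.\<close>

lemma geometric_steps_convergent:
  fixes y :: "nat \<Rightarrow> 'a::complete_space"
  assumes q: "0 \<le> q" "q < 1"
    and step: "\<And>n. dist (y n) (y (Suc n)) \<le> D * q ^ n"
  obtains l where "y \<longlonglongrightarrow> l" and "\<And>n. dist (y n) l \<le> D / (1 - q) * q ^ n"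
proof -
  have D: "0 \<le> D" using order_trans[OF zero_le_dist step[of 0]] by simp
  have geo: "D * (\<Sum>i<n. q ^ i) \<le> D / (1 - q)" for n
    using mult_left_mono[OF geometric_partial_sum_le[OF q] D] by simp
  have tail: "dist (y n) (y (n + k)) \<le> D / (1 - q) * q ^ n" for n k
  proof -
    have "dist (y n) (y (n + k)) \<le> D * q ^ n * (\<Sum>i<k. q ^ i)"
    proof (induction k)
      case (Suc k)
      have "dist (y n) (y (n + Suc k)) \<le> dist (y n) (y (n + k)) + dist (y (n + k)) (y (Suc (n + k)))"
        using dist_triangle by simp
      also have "\<dots> \<le> D * q ^ n * (\<Sum>i<k. q ^ i) + D * q ^ (n + k)"
        using Suc step[of "n + k"] by (intro add_mono) auto
      finally show ?case by (simp add: algebra_simps power_add)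
    qed simp
    also have "\<dots> = (D * (\<Sum>i<k. q ^ i)) * q ^ n" by simp
    also have "\<dots> \<le> D / (1 - q) * q ^ n"
      using q by (intro mult_right_mono geo) auto
    finally show ?thesis .
  qed
  have "(\<lambda>n. D / (1 - q) * q ^ n) \<longlonglongrightarrow> D / (1 - q) * 0"
    using q by (intro tendsto_intros LIMSEQ_power_zero) auto
  then have lim0: "(\<lambda>n. D / (1 - q) * q ^ n) \<longlonglongrightarrow> 0" by simp
  have "Cauchy y"
  proof (rule CauchyI')
    fix e :: real assume "0 < e"
    with lim0 obtain M where M: "\<And>n. n \<ge> M \<Longrightarrow> D / (1 - q) * q ^ n < e"
      using order_tendstoD(2)[of _ 0 sequentially e] unfolding eventually_sequentially by blast
    show "\<exists>M. \<forall>m\<ge>M. \<forall>n>m. dist (y m) (y n) < e"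
      using M tail le_less_trans by (metis le_add_diff_inverse less_imp_le)
  qed
  then obtain l where l: "y \<longlonglongrightarrow> l" by (meson Cauchy_convergent_iff convergentD)
  have "dist (y n) l \<le> D / (1 - q) * q ^ n" for n
  proof (rule LIMSEQ_le_const2)
    show "(\<lambda>k. dist (y n) (y (k + n))) \<longlonglongrightarrow> dist (y n) l"
      by (intro tendsto_intros LIMSEQ_ignore_initial_segment l)
  qed (use tail[of n] in \<open>auto simp: add.commute\<close>)
  with l that show thesis by blast
qed

text \<open>The contraction is available only near \<open>p\<close>. The geometric series bounds the total length of the
  trajectory, so a sequence that starts close enough to \<open>p\<close> never leaves the region where it holds.\<close>

lemma convergent_of_local_contraction:
  fixes y :: "nat \<Rightarrow> 'a::complete_space"
  assumes q: "0 \<le> q" "q < 1"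
    and start: "dist (y 0) p + dist (y 0) (y 1) / (1 - q) < \<rho>"
    and contr: "\<And>n. dist (y n) p + dist (y n) (y (Suc n)) < \<rho> \<Longrightarrow>
                  dist (y (Suc n)) (y (Suc (Suc n))) \<le> q * dist (y n) (y (Suc n))"
  obtains l where "y \<longlonglongrightarrow> l"
    and "\<And>n. dist (y n) l \<le> dist (y 0) (y 1) / (1 - q) * q ^ n"
proof -
  define D where "D = dist (y 0) (y 1)"
  have D: "0 \<le> D" by (simp add: D_def)
  have geo: "D * (\<Sum>i<n. q ^ i) \<le> D / (1 - q)" for n
    using mult_left_mono[OF geometric_partial_sum_le[OF q] D] by simp
  have inv: "dist (y n) p \<le> dist (y 0) p + D * (\<Sum>i<n. q ^ i) \<and> dist (y n) (y (Suc n)) \<le> D * q ^ n"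
    for n
  proof (induction n)
    case 0
    then show ?case by (simp add: D_def)
  next
    case (Suc n)
    have "dist (y n) p + dist (y n) (y (Suc n)) \<le> dist (y 0) p + D * (\<Sum>i<Suc n. q ^ i)"
      using Suc by (simp add: algebra_simps)
    moreover from this have "dist (y n) p + dist (y n) (y (Suc n)) < \<rho>"
      using geo[of "Suc n"] start unfolding D_def by linarith
    then have "dist (y (Suc n)) (y (Suc (Suc n))) \<le> q * dist (y n) (y (Suc n))"
      by (rule contr)
    moreover have "\<dots> \<le> q * (D * q ^ n)" using Suc q by (intro mult_left_mono) auto
    moreover have "dist (y (Suc n)) p \<le> dist (y n) p + dist (y n) (y (Suc n))"
      by (metis dist_commute dist_triangle)
    ultimately show ?case by (simp add: algebra_simps)
  qed
  from inv obtain l where "y \<longlonglongrightarrow> l" "\<And>n. dist (y n) l \<le> D / (1 - q) * q ^ n"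
    using geometric_steps_convergent[OF q, of y D] by blast
  then show thesis using that unfolding D_def by blast
qed

section \<open>Frechet normals\<close>

lemma frechet_normal_cone_iff:
  "u \<in> frechet_normal_cone A a \<longleftrightarrow>
     (\<forall>e>0. \<forall>\<^sub>F x in at a within A. u \<bullet> (x - a) \<le> e * norm (x - a))"
proof
  assume u: "u \<in> frechet_normal_cone A a"
  show "\<forall>e>0. \<forall>\<^sub>F x in at a within A. u \<bullet> (x - a) \<le> e * norm (x - a)"
  proof (intro allI impI)
    fix e :: real assume "e > 0"
    then have "0 < ereal e" by simp
    with u have "\<forall>\<^sub>F x in at a within A. ereal ((u \<bullet> (x - a)) / norm (x - a)) < ereal e"
      unfolding frechet_normal_cone_def Limsup_le_iff mem_Collect_eq by blast
    moreover have "\<forall>\<^sub>F x in at a within A. x \<noteq> a"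
      by (simp add: eventually_at_filter)
    ultimately show "\<forall>\<^sub>F x in at a within A. u \<bullet> (x - a) \<le> e * norm (x - a)"
      by eventually_elim (auto simp: field_simps)
  qed
next
  assume u: "\<forall>e>0. \<forall>\<^sub>F x in at a within A. u \<bullet> (x - a) \<le> e * norm (x - a)"
  have "\<forall>\<^sub>F x in at a within A. ereal ((u \<bullet> (x - a)) / norm (x - a)) < y" if "0 < y" for y
  proof -
    from that obtain e where e: "0 < ereal e" "ereal e < y"
      using ereal_dense2 by blast
    with u have "\<forall>\<^sub>F x in at a within A. u \<bullet> (x - a) \<le> e * norm (x - a)"
      by simp
    moreover have "\<forall>\<^sub>F x in at a within A. x \<noteq> a"
      by (simp add: eventually_at_filter)
    ultimately show ?thesis
    proof eventually_elim
      case (elim x)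
      then have "(u \<bullet> (x - a)) / norm (x - a) \<le> e"
        by (auto simp: field_simps)
      then show ?case
        using e(2) by (metis ereal_less_eq(3) le_less_trans)
    qed
  qed
  then show "u \<in> frechet_normal_cone A a"
    by (auto simp: frechet_normal_cone_def Limsup_le_iff)
qed

lemma frechet_normal_cone_scaleR:
  assumes "u \<in> frechet_normal_cone A a" and "0 \<le> k"
  shows "k *\<^sub>R u \<in> frechet_normal_cone A a"
proof (cases "k = 0")
  case True
  then show ?thesis by (simp add: zero_in_frechet_normal_cone)
next
  case False
  with assms(2) have k: "k > 0" by simp
  show ?thesis
    unfolding frechet_normal_cone_iff
  proof (intro allI impI)
    fix e :: real assume "e > 0"
    with k have "0 < e / k" by simp
    with assms(1) have "\<forall>\<^sub>F x in at a within A. u \<bullet> (x - a) \<le> (e / k) * norm (x - a)"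
      unfolding frechet_normal_cone_iff by blast
    then show "\<forall>\<^sub>F x in at a within A. (k *\<^sub>R u) \<bullet> (x - a) \<le> e * norm (x - a)"
      by eventually_elim (use k in \<open>auto simp: field_simps\<close>)
  qed
qed

lemma infdist_frechet_normal_cone_scaleR_le:
  assumes "0 < k"
  shows "infdist (k *\<^sub>R u) (frechet_normal_cone A a) \<le> k * infdist u (frechet_normal_cone A a)"
proof -
  let ?N = "frechet_normal_cone A a"
  have ne: "?N \<noteq> {}" using zero_in_frechet_normal_cone by blast
  have "infdist (k *\<^sub>R u) ?N / k \<le> dist u y" if "y \<in> ?N" for y
  proof -
    have "infdist (k *\<^sub>R u) ?N \<le> dist (k *\<^sub>R u) (k *\<^sub>R y)"
      using that assms by (intro infdist_le frechet_normal_cone_scaleR) auto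
    also have "\<dots> = k * dist u y"
      using assms by (simp add: dist_norm flip: scaleR_diff_right)
    finally show ?thesis using assms by (simp add: field_simps)
  qed
  then have "infdist (k *\<^sub>R u) ?N / k \<le> infdist u ?N"
    unfolding infdist_notempty[OF ne] by (intro cINF_greatest ne)
  then show ?thesis using assms by (simp add: field_simps)
qed

text \<open>Fermat's rule. Differentiability of \<open>F\<close> is what turns a minimum over a nonconvex set into a normal
  at the minimiser itself.\<close>

lemma minus_gradient_in_frechet_normal_cone:
  assumes der: "(F has_derivative (\<lambda>h. G \<bullet> h)) (at x)"
    and min: "\<And>y. y \<in> A \<Longrightarrow> F x \<le> F y"
  shows "- G \<in> frechet_normal_cone A x"
  unfolding frechet_normal_cone_iff
proof (intro allI impI)
  fix e :: real assume "e > 0"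
  then obtain d where d: "d > 0"
    "\<And>y. norm (y - x) < d \<Longrightarrow> norm (F y - F x - G \<bullet> (y - x)) \<le> e * norm (y - x)"
    using der unfolding has_derivative_at_alt by blast
  show "\<forall>\<^sub>F y in at x within A. - G \<bullet> (y - x) \<le> e * norm (y - x)"
    unfolding eventually_at
  proof (intro exI[of _ d] conjI ballI impI)
    fix y assume y: "y \<in> A" "y \<noteq> x \<and> dist y x < d"
    then have "norm (F y - F x - G \<bullet> (y - x)) \<le> e * norm (y - x)"
      using d(2)[of y] by (simp add: dist_norm)
    with min[OF y(1)] show "- G \<bullet> (y - x) \<le> e * norm (y - x)"
      by simp
  qed (fact d(1))
qed

section \<open>A smooth variational principle\<close>

text \<open>Almost minimise, add a small multiple of the squared distance to the point found, almost minimise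
  again with a much smaller error, and so on. Each new point has to stay close to the previous one,
  since otherwise the quadratic term just added would exceed the error allowed; so the points
  converge, and their limit minimises \<open>f\<close> plus all the added terms. In an inner product space a
  weighted sum of squared distances to several points is, up to a constant, the squared distance to
  their barycentre, so a single quadratic term remains. The last conclusion bounds
  \<open>\<alpha> * norm (x - z)\<close> by \<open>sqrt (\<alpha> * (f x0 - m))\<close>, which makes the gradient of the perturbation small
  together with \<open>\<alpha>\<close>.\<close>

lemma quadratic_perturbation_attains_min:
  fixes A :: "'a::{real_inner, complete_space} set"
  assumes "closed A" and "x0 \<in> A" and cont: "continuous_on A f"
    and lower: "\<And>x. x \<in> A \<Longrightarrow> m \<le> f x" and \<alpha>: "0 < \<alpha>"
  obtains x z where "x \<in> A"
    and "\<And>y. y \<in> A \<Longrightarrow> f x + \<alpha> * (norm (x - z))\<^sup>2 \<le> f y + \<alpha> * (norm (y - z))\<^sup>2"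
    and "f x + \<alpha> * (norm (x - z))\<^sup>2 \<le> f x0"
proof -
  define w :: "nat \<Rightarrow> real" where "w n = (1 / 2) ^ Suc n" for n
  define E where "E = f x0 - m + 1"
  have E: "E > 0" using lower[OF \<open>x0 \<in> A\<close>] by (simp add: E_def)
  have w_pos: "w n > 0" for n by (simp add: w_def)
  have w_sums: "w sums 1"
    unfolding w_def using power_half_series by simp
  \<comment> \<open>A state is a pair of the function perturbed so far and its current approximate minimiser.\<close>
  define P where "P n s \<longleftrightarrow> snd s \<in> A \<and>
      (\<forall>y\<in>A. m \<le> fst s y \<and> fst s (snd s) \<le> fst s y + E * (1 / 8) ^ n) \<and>
      (n = 0 \<longrightarrow> s = (f, x0))" for n and s :: "('a \<Rightarrow> real) \<times> 'a"
  define Q where "Q n s s' \<longleftrightarrow>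
      fst s' = (\<lambda>y. fst s y + \<alpha> * w n * (norm (y - snd s))\<^sup>2) \<and>
      fst s' (snd s') \<le> fst s (snd s)" for n and s s' :: "('a \<Rightarrow> real) \<times> 'a"
  have "\<exists>s. \<forall>n. P n (s n) \<and> Q n (s n) (s (Suc n))"
  proof (rule dependent_nat_choice)
    show "\<exists>s. P 0 s"
      using \<open>x0 \<in> A\<close> lower by (intro exI[of _ "(f, x0)"]) (force simp: P_def E_def)
  next
    fix s n assume s: "P n s"
    define g where "g y = fst s y + \<alpha> * w n * (norm (y - snd s))\<^sup>2" for y
    have sA: "snd s \<in> A" using s by (simp add: P_def)
    have g_lower: "m \<le> g y" if "y \<in> A" for y
      using s that \<alpha> w_pos[of n] by (auto simp: P_def g_def intro!: add_increasing2)
    define i where "i = (INF y\<in>A. g y)"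
    have i_le: "i \<le> g y" if "y \<in> A" for y
      unfolding i_def using that g_lower by (intro cINF_lower bdd_belowI2[where m = m]) auto
    have "\<exists>x\<in>A. g x \<le> g (snd s) \<and> g x \<le> i + E * (1 / 8) ^ Suc n"
    proof (cases "g (snd s) \<le> i + E * (1 / 8) ^ Suc n")
      case True
      then show ?thesis using sA by blast
    next
      case False
      have "i < i + E * (1 / 8) ^ Suc n" using E by simp
      then obtain x where "x \<in> A" "g x < i + E * (1 / 8) ^ Suc n"
        unfolding i_def using sA g_lower
        by (subst (asm) cINF_less_iff) (auto intro!: bdd_belowI2[where m = m])
      with False show ?thesis by (intro bexI[of _ x]) auto
    qed
    then obtain x where x: "x \<in> A" "g x \<le> g (snd s)" "g x \<le> i + E * (1 / 8) ^ Suc n"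
      by blast
    have "g (snd s) = fst s (snd s)" by (simp add: g_def)
    moreover have "g x \<le> g y + E * (1 / 8) ^ Suc n" if "y \<in> A" for y
      using x(3) i_le[OF that] by linarith
    ultimately show "\<exists>s'. P (Suc n) s' \<and> Q n s s'"
      using x g_lower by (intro exI[of _ "(g, x)"]) (auto simp: P_def Q_def g_def[abs_def])
  qed
  then obtain s where s: "\<And>n. P n (s n)" "\<And>n. Q n (s n) (s (Suc n))" by blast
  define g x where "g n = fst (s n)" and "x n = snd (s n)" for n
  have x_in: "x n \<in> A" for n
    using s(1)[of n] by (simp add: P_def x_def)
  have g0: "g 0 = f" "x 0 = x0"
    using s(1)[of 0] by (auto simp: P_def g_def x_def)
  have near: "g n (x n) \<le> g n y + E * (1 / 8) ^ n" if "y \<in> A" for n y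
    using s(1)[of n] that by (auto simp: P_def g_def x_def)
  have g_Suc: "g (Suc n) y = g n y + \<alpha> * w n * (norm (y - x n))\<^sup>2" for n y
    using s(2)[of n] by (simp add: Q_def g_def x_def)
  have descent: "g (Suc n) (x (Suc n)) \<le> g n (x n)" for n
    using s(2)[of n] unfolding Q_def g_def x_def by (rule conjunct2)
  have g_eq: "g n y = f y + \<alpha> * (\<Sum>i<n. w i * (norm (y - x i))\<^sup>2)" for n y
    by (induction n) (simp_all add: g0 g_Suc algebra_simps)
  have g_mono: "g k y \<le> g n y" if "k \<le> n" for k n y
    using that by (rule lift_Suc_mono_le[of "\<lambda>n. g n y", rotated])
      (use \<alpha> w_pos in \<open>simp add: g_Suc less_imp_le\<close>)
  have g_x_le: "g n (x n) \<le> f x0" for n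
    by (induction n) (use descent order_trans in \<open>auto simp: g0\<close>)
  \<comment> \<open>The errors \<open>8\<^sup>-\<^sup>n\<close> against the weights \<open>2\<^sup>-\<^sup>n\<close> leave squared steps of order \<open>4\<^sup>-\<^sup>n\<close>.\<close>
  define K where "K = sqrt (2 * E / \<alpha>)"
  have step: "norm (x (Suc n) - x n) \<le> K * (1 / 2) ^ n" for n
  proof -
    have "\<alpha> * w n * (norm (x (Suc n) - x n))\<^sup>2 \<le> E * (1 / 8) ^ n"
      using descent[of n] near[OF x_in, of n "Suc n"] g_Suc[of n "x (Suc n)"] by linarith
    moreover have "((1::real) / 8) ^ n = (1 / 2) ^ n * ((1 / 2) ^ n)\<^sup>2"
      by (simp add: power_divide flip: power_mult power_mult_distrib power_add)
         (simp add: power_mult flip: power_mult_distrib)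
    ultimately have "(norm (x (Suc n) - x n))\<^sup>2 \<le> 2 * E / \<alpha> * ((1 / 2) ^ n)\<^sup>2"
      using \<alpha> by (simp add: w_def field_simps)
    also have "\<dots> = (K * (1 / 2) ^ n)\<^sup>2"
      using \<alpha> E by (simp add: K_def power_mult_distrib)
    finally show ?thesis
      by (rule power2_le_imp_le) (use \<alpha> E in \<open>simp add: K_def\<close>)
  qed
  obtain xs where xs: "x \<longlonglongrightarrow> xs"
    by (rule geometric_steps_convergent[of "1 / 2" x K])
       (use step in \<open>auto simp: dist_norm norm_minus_commute\<close>)
  have xs_in: "xs \<in> A"
    using \<open>closed A\<close> x_in xs by (metis closed_sequentially)
  obtain R where R: "\<And>n. norm (x n) \<le> R"
    using convergent_imp_Bseq[of x] xs by (auto simp: convergent_def Bseq_def)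
  have summ_w: "summable w" using w_sums by (rule sums_summable)
  have summ: "summable (\<lambda>i. w i * (norm (y - x i))\<^sup>2)" for y
  proof (rule summable_comparison_test'[where g = "\<lambda>i. w i * (norm y + R)\<^sup>2" and N = 0])
    show "summable (\<lambda>i. w i * (norm y + R)\<^sup>2)"
      by (intro summable_mult2 summ_w)
    fix n
    have "norm (y - x n) \<le> norm y + R"
      using norm_triangle_ineq4[of y "x n"] R[of n] by linarith
    then show "norm (w n * (norm (y - x n))\<^sup>2) \<le> w n * (norm y + R)\<^sup>2"
      using w_pos[of n] by (auto simp: abs_mult intro!: mult_left_mono power_mono)
  qed
  obtain z where z: "(\<lambda>i. w i *\<^sub>R x i) sums z"
  proof (rule geometric_steps_convergent[of "1 / 2" "\<lambda>n. \<Sum>i<n. w i *\<^sub>R x i" R])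
    fix n
    have "norm (w n *\<^sub>R x n) \<le> (1 / 2) ^ n * R"
      unfolding norm_scaleR by (intro mult_mono R) (auto simp: w_def)
    then show "dist (\<Sum>i<n. w i *\<^sub>R x i) (\<Sum>i<Suc n. w i *\<^sub>R x i) \<le> R * (1 / 2) ^ n"
      by (simp add: dist_norm mult.commute)
  qed (auto simp: sums_def)
  define S where "S y = (\<Sum>i. w i * (norm (y - x i))\<^sup>2)" for y
  \<comment> \<open>The weights sum to 1, so \<open>z\<close> is the barycentre of the points \<open>x i\<close> and the mixed terms cancel.\<close>
  have S_eq: "S y = (norm (y - z))\<^sup>2 + S z" for y
  proof -
    have "(\<lambda>i. w i *\<^sub>R z - w i *\<^sub>R x i) sums (1 *\<^sub>R z - z)"
      by (intro sums_diff z bounded_linear.sums[OF bounded_linear_scaleR_left] w_sums)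
    then have "(\<lambda>i. (2 *\<^sub>R (y - z)) \<bullet> (w i *\<^sub>R z - w i *\<^sub>R x i)) sums 0"
      using bounded_linear.sums[OF bounded_linear_inner_right, of _ "1 *\<^sub>R z - z" "2 *\<^sub>R (y - z)"]
      by simp
    moreover have "(\<lambda>i. w i * (norm (y - z))\<^sup>2) sums (1 * (norm (y - z))\<^sup>2)"
      by (intro sums_mult2 w_sums)
    ultimately have "(\<lambda>i. w i * (norm (y - z))\<^sup>2 +
        (2 *\<^sub>R (y - z)) \<bullet> (w i *\<^sub>R z - w i *\<^sub>R x i) + w i * (norm (z - x i))\<^sup>2)
        sums (1 * (norm (y - z))\<^sup>2 + 0 + S z)"
      unfolding S_def by (intro sums_add summable_sums summ)
    moreover have "w i * (norm (y - z))\<^sup>2 + (2 *\<^sub>R (y - z)) \<bullet> (w i *\<^sub>R z - w i *\<^sub>R x i)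
        + w i * (norm (z - x i))\<^sup>2 = w i * (norm (y - x i))\<^sup>2" for i
      by (simp add: power2_norm_eq_inner algebra_simps inner_commute)
    ultimately show ?thesis
      unfolding S_def[of y] by (simp add: sums_unique[symmetric])
  qed
  have S_nonneg: "0 \<le> S y" for y
    unfolding S_def by (intro suminf_nonneg summ) (use w_pos in \<open>simp add: less_imp_le\<close>)
  have g_le: "g n y \<le> f y + \<alpha> * S y" for n y
    unfolding g_eq S_def using \<alpha> w_pos
    by (intro add_left_mono mult_left_mono sum_le_suminf summ) (auto simp: less_imp_le)
  have g_lim: "(\<lambda>n. g n y) \<longlonglongrightarrow> f y + \<alpha> * S y" for y
    unfolding g_eq S_def by (intro tendsto_intros summable_LIMSEQ summ)
  have g_k_lim: "(\<lambda>n. g k (x n)) \<longlonglongrightarrow> g k xs" for k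
    unfolding g_eq
    by (intro tendsto_intros xs continuous_on_tendsto_compose[OF cont xs xs_in] always_eventually)
       (simp add: x_in)
  \<comment> \<open>Continuity applies to \<open>g k\<close> for a fixed \<open>k\<close> only, so \<open>n\<close> tends to infinity before \<open>k\<close> does.\<close>
  have limit_le: "f xs + \<alpha> * S xs \<le> c"
    if "\<And>n. g n (x n) \<le> c + E * (1 / 8) ^ n" for c
  proof -
    have "g k xs \<le> c" for k
    proof (rule tendsto_le[OF sequentially_bot _ g_k_lim])
      show "(\<lambda>n. c + E * (1 / 8) ^ n) \<longlonglongrightarrow> c"
        by (rule tendsto_eq_intros LIMSEQ_power_zero refl | simp)+
      show "\<forall>\<^sub>F n in sequentially. g k (x n) \<le> c + E * (1 / 8) ^ n"
        using eventually_ge_at_top[of k]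
        by eventually_elim (use that g_mono order_trans in blast)
    qed
    then show ?thesis by (intro LIMSEQ_le_const2[OF g_lim]) auto
  qed
  show thesis
  proof
    show "xs \<in> A" by (fact xs_in)
    show "f xs + \<alpha> * (norm (xs - z))\<^sup>2 \<le> f y + \<alpha> * (norm (y - z))\<^sup>2" if "y \<in> A" for y
    proof -
      have "f xs + \<alpha> * S xs \<le> f y + \<alpha> * S y"
        by (rule limit_le) (use near[OF that] g_le order_trans add_right_mono in blast)
      then show ?thesis
        unfolding S_eq[of xs] S_eq[of y] by (simp add: algebra_simps)
    qed
    have "f xs + \<alpha> * S xs \<le> f x0"
      by (rule limit_le) (use g_x_le E in \<open>simp add: add_increasing2\<close>)
    moreover have "0 \<le> \<alpha> * S z" using \<alpha> S_nonneg by simp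
    ultimately show "f xs + \<alpha> * (norm (xs - z))\<^sup>2 \<le> f x0"
      unfolding S_eq[of xs] by (simp add: algebra_simps)
  qed
qed

section \<open>Decrease of the distance at non-normal pairs\<close>

text \<open>Minimising \<open>norm (x - b) + \<gamma> * norm (x - a)\<close> over \<open>A\<close>, up to a smoothing error \<open>\<eta>\<close> in the value
  and a perturbation error \<open>\<omega>\<close> in the gradient. Penalising the distance to the starting point \<open>a\<close>
  itself keeps the minimiser close to \<open>a\<close>, with the best possible constant.\<close>

lemma obtain_penalised_minimum:
  fixes A :: "'a::{real_inner, complete_space} set"
  assumes "closed A" and "a \<in> A" and "b \<notin> A" and "0 < \<gamma>" and "0 < \<eta>" and "0 < \<omega>"
  obtains x where "x \<in> A" and "norm (x - b) \<le> norm (a - b)"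
    and "norm (x - b) + \<gamma> * norm (x - a) \<le> norm (a - b) + \<gamma> * \<eta>"
    and "infdist ((b - x) /\<^sub>R norm (x - b)) (frechet_normal_cone A x) \<le> \<gamma> + \<omega>"
proof -
  define s where "s x = sqrt ((x - a) \<bullet> (x - a) + \<eta>\<^sup>2)" for x
  define f where "f x = norm (x - b) + \<gamma> * s x" for x
  have pos: "(x - a) \<bullet> (x - a) + \<eta>\<^sup>2 > 0" for x
    using \<open>0 < \<eta>\<close> by (intro add_nonneg_pos) auto
  have s_ge: "\<eta> \<le> s x" "norm (x - a) \<le> s x" for x
    using \<open>0 < \<eta>\<close> unfolding s_def by (auto intro!: real_le_rsqrt simp: dot_square_norm)
  have s_pos: "s x > 0" for x using s_ge(1)[of x] \<open>0 < \<eta>\<close> by linarith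
  have s_a: "s a = \<eta>" using \<open>0 < \<eta>\<close> by (simp add: s_def)
  have f_a: "f a = norm (a - b) + \<gamma> * \<eta>" by (simp add: f_def s_a)
  have f_a_pos: "f a > 0" using assms by (auto simp: f_a intro!: add_nonneg_pos)
  \<comment> \<open>The gradient \<open>2 * \<alpha> * norm (x - z)\<close> of the perturbation is then at most \<open>\<omega>\<close>.\<close>
  define \<alpha> where "\<alpha> = \<omega>\<^sup>2 / (4 * f a)"
  have \<alpha>: "\<alpha> > 0" using f_a_pos \<open>0 < \<omega>\<close> by (simp add: \<alpha>_def)
  have "continuous_on A f"
    unfolding f_def s_def by (intro continuous_intros)
  moreover have f_nonneg: "0 \<le> f x" for x
    using s_pos[of x] \<open>0 < \<gamma>\<close> by (simp add: f_def)
  ultimately obtain x z where x: "x \<in> A"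
    and min: "\<And>y. y \<in> A \<Longrightarrow> f x + \<alpha> * (norm (x - z))\<^sup>2 \<le> f y + \<alpha> * (norm (y - z))\<^sup>2"
    and le: "f x + \<alpha> * (norm (x - z))\<^sup>2 \<le> f a"
    using quadratic_perturbation_attains_min[OF \<open>closed A\<close> \<open>a \<in> A\<close>, of f 0 \<alpha>] \<alpha> by blast
  have "x \<noteq> b" using x \<open>b \<notin> A\<close> by blast
  define G where "G = (x - b) /\<^sub>R norm (x - b) + (\<gamma> / s x) *\<^sub>R (x - a) + (2 * \<alpha>) *\<^sub>R (x - z)"
  have "((\<lambda>y. f y + \<alpha> * ((y - z) \<bullet> (y - z))) has_derivative (\<lambda>h. G \<bullet> h)) (at x)"
  proof -
    have norm_der: "((\<lambda>y. norm (y - b)) has_derivative (\<lambda>h. sgn (x - b) \<bullet> h)) (at x)"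
    proof -
      have "((\<lambda>y. y - b) has_derivative (\<lambda>h. h)) (at x)"
        by (auto intro!: derivative_eq_intros)
      from has_derivative_compose[OF this has_derivative_norm[of "x - b"]]
      show ?thesis using \<open>x \<noteq> b\<close> by (simp add: inner_commute)
    qed
    have s_der: "(s has_derivative (\<lambda>h. ((x - a) \<bullet> h) / s x)) (at x)"
      unfolding s_def
      by (rule derivative_eq_intros refl | simp add: pos)+
         (auto simp: inner_commute field_simps)
    have sq_der: "((\<lambda>y. (y - z) \<bullet> (y - z)) has_derivative (\<lambda>h. 2 * ((x - z) \<bullet> h))) (at x)"
      by (auto intro!: derivative_eq_intros simp: inner_commute)
    show ?thesis
      unfolding f_def
      by (rule derivative_eq_intros norm_der s_der sq_der refl)+
         (simp add: G_def sgn_div_norm inner_add_left fun_eq_iff)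
  qed
  then have "- G \<in> frechet_normal_cone A x"
    by (rule minus_gradient_in_frechet_normal_cone) (use min in \<open>simp add: dot_square_norm\<close>)
  then have "infdist ((b - x) /\<^sub>R norm (x - b)) (frechet_normal_cone A x)
      \<le> dist ((b - x) /\<^sub>R norm (x - b)) (- G)"
    by (rule infdist_le)
  also have "\<dots> = norm ((\<gamma> / s x) *\<^sub>R (x - a) + (2 * \<alpha>) *\<^sub>R (x - z))"
    by (simp add: dist_norm G_def algebra_simps)
  also have "\<dots> \<le> \<gamma> / s x * norm (x - a) + 2 * \<alpha> * norm (x - z)"
    using norm_triangle_ineq[of "(\<gamma> / s x) *\<^sub>R (x - a)" "(2 * \<alpha>) *\<^sub>R (x - z)"]
      \<open>0 < \<gamma>\<close> s_pos[of x] \<alpha> by simp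
  also have "\<dots> \<le> \<gamma> + \<omega>"
  proof (rule add_mono)
    show "\<gamma> / s x * norm (x - a) \<le> \<gamma>"
      using s_ge(2)[of x] s_pos[of x] \<open>0 < \<gamma>\<close> by (simp add: field_simps)
    have "\<alpha> * (norm (x - z))\<^sup>2 \<le> f a" using le f_nonneg[of x] by linarith
    then have "4 * \<alpha> * (\<alpha> * (norm (x - z))\<^sup>2) \<le> 4 * \<alpha> * f a" using \<alpha> by simp
    then have "(2 * \<alpha> * norm (x - z))\<^sup>2 \<le> \<omega>\<^sup>2"
      using f_a_pos by (simp add: power2_eq_square \<alpha>_def field_simps)
    then show "2 * \<alpha> * norm (x - z) \<le> \<omega>"
      by (rule power2_le_imp_le) (use \<open>0 < \<omega>\<close> in simp)
  qed
  finally have normal: "infdist ((b - x) /\<^sub>R norm (x - b)) (frechet_normal_cone A x) \<le> \<gamma> + \<omega>" .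
  have "f x \<le> norm (a - b) + \<gamma> * \<eta>"
  proof -
    have "0 \<le> \<alpha> * (norm (x - z))\<^sup>2" using \<alpha> by simp
    then show ?thesis using le unfolding f_a by linarith
  qed
  moreover have "\<gamma> * \<eta> \<le> \<gamma> * s x" "\<gamma> * norm (x - a) \<le> \<gamma> * s x"
    using s_ge[of x] \<open>0 < \<gamma>\<close> by simp_all
  ultimately show thesis
    using x normal by (intro that) (auto simp: f_def)
qed

text \<open>The law of cosines, for the triangle with sides \<open>u\<close> and \<open>v\<close>.\<close>

lemma direction_change_square:
  fixes u v :: "'a::real_inner"
  assumes "u \<noteq> 0" and "v \<noteq> 0"
  shows "(norm (u /\<^sub>R norm u - v /\<^sub>R norm v))\<^sup>2 * (norm u * norm v) =
           (norm (u - v))\<^sup>2 - (norm u - norm v)\<^sup>2"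
proof -
  have "(norm (u /\<^sub>R norm u - v /\<^sub>R norm v))\<^sup>2 =
      (norm (u /\<^sub>R norm u))\<^sup>2 + (norm (v /\<^sub>R norm v))\<^sup>2 - 2 * ((u /\<^sub>R norm u) \<bullet> (v /\<^sub>R norm v))"
    by (simp add: power2_norm_eq_inner inner_diff inner_commute
        del: inner_scaleR_left inner_scaleR_right norm_scaleR)
  also have "\<dots> = 2 - 2 * ((u \<bullet> v) / (norm u * norm v))"
    using assms by (simp add: field_simps)
  finally have unit: "(norm (u /\<^sub>R norm u - v /\<^sub>R norm v))\<^sup>2 =
      2 - 2 * ((u \<bullet> v) / (norm u * norm v))" .
  have diff: "(norm (u - v))\<^sup>2 = (norm u)\<^sup>2 + (norm v)\<^sup>2 - 2 * (u \<bullet> v)"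
    by (simp add: power2_norm_eq_inner inner_diff inner_commute)
  show ?thesis
    unfolding unit diff using assms by (simp add: field_simps power2_eq_square)
qed

text \<open>Here \<open>T\<close> stands for \<open>norm (x - a)\<close>, \<open>p\<close> for \<open>norm (x - b)\<close> and \<open>r\<close> for \<open>norm (a - b)\<close>. For
  \<open>\<eta> = 0\<close> the conclusion says, by \<open>direction_change_square\<close>, that the directions from \<open>b\<close> to \<open>x\<close> and
  to \<open>a\<close> differ by at most \<open>\<kappa>\<close>. The bound \<open>T \<le> \<kappa> * r\<close> alone would not suffice, since \<open>x\<close> may be
  closer to \<open>b\<close> than \<open>a\<close>, which enlarges the angle; it suffices as soon as \<open>r - p\<close> is at least
  \<open>\<kappa>\<^sup>2 * r\<close>. For smaller \<open>r - p\<close> the penalty makes \<open>T\<close> small in proportion to \<open>r - p\<close>.\<close>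

lemma penalised_step_bound:
  fixes T r p \<kappa> \<gamma> \<eta> :: real
  assumes "0 < \<kappa>" "\<kappa> \<le> 1" "\<kappa> \<le> \<gamma>" "0 \<le> \<eta>" "0 \<le> T" "p \<le> r"
    and T: "T \<le> \<kappa> * r" "\<gamma> * T \<le> (r - p) + \<gamma> * \<eta>"
  shows "T\<^sup>2 \<le> \<kappa>\<^sup>2 * (r * p) + (r - p)\<^sup>2 + (2 * \<eta> * \<kappa> * r + \<eta>\<^sup>2)"
proof -
  define e where "e = r - p"
  have e: "0 \<le> e" "p = r - e" using assms by (auto simp: e_def)
  have "0 \<le> \<kappa> * r" using assms by linarith
  then have r: "0 \<le> r" using \<open>0 < \<kappa>\<close> by (simp add: zero_le_mult_iff)
  show ?thesis
  proof (cases "\<kappa>\<^sup>2 * r \<le> e")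
    case True
    have "T\<^sup>2 \<le> (\<kappa> * r)\<^sup>2" using assms by (intro power_mono) auto
    also have "\<dots> \<le> (\<kappa> * r)\<^sup>2 + e * (e - \<kappa>\<^sup>2 * r)" using True e by simp
    also have "\<dots> = \<kappa>\<^sup>2 * (r * p) + (r - p)\<^sup>2"
      by (simp add: e(2) power2_eq_square algebra_simps)
    also have "\<dots> \<le> \<dots> + (2 * \<eta> * \<kappa> * r + \<eta>\<^sup>2)" using assms r by simp
    finally show ?thesis .
  next
    case False
    define q where "q = e / \<kappa>"
    have q: "0 \<le> q" "e = \<kappa> * q" "q \<le> \<kappa> * r" using False e(1) assms
      by (auto simp: q_def field_simps power2_eq_square)
    have "\<gamma> * (T - \<eta>) \<le> e" using T(2) by (simp add: e_def algebra_simps)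
    moreover have "\<kappa> * (T - \<eta>) \<le> max 0 (\<gamma> * (T - \<eta>))"
      using assms by (cases "T \<le> \<eta>") (auto simp: mult_nonneg_nonpos le_max_iff_disj)
    ultimately have "\<kappa> * (T - \<eta>) \<le> e" using e(1) by simp
    then have "T - \<eta> \<le> q" using assms by (simp add: q_def field_simps)
    then have "T\<^sup>2 \<le> (q + \<eta>)\<^sup>2" using assms by (intro power_mono) auto
    also have "\<dots> = q\<^sup>2 + (2 * \<eta> * q + \<eta>\<^sup>2)"
      by (simp add: power2_eq_square algebra_simps)
    also have "\<dots> \<le> q\<^sup>2 + (2 * \<eta> * (\<kappa> * r) + \<eta>\<^sup>2)"
      using q assms by (intro add_left_mono add_right_mono mult_left_mono) auto
    also have "q\<^sup>2 \<le> \<kappa>\<^sup>2 * (r * p) + (r - p)\<^sup>2"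
    proof -
      have "\<kappa> * \<kappa> * q \<le> 1 * q" using q assms by (intro mult_right_mono mult_le_one) auto
      then have "0 \<le> (\<kappa> * r - q) * (\<kappa> * r + q - \<kappa>\<^sup>2 * q)"
        using q r assms by (intro mult_nonneg_nonneg) (auto simp: power2_eq_square)
      then show ?thesis by (simp add: e(2) q(2) power2_eq_square algebra_simps)
    qed
    finally show ?thesis by simp
  qed
qed

text \<open>The maximum with \<open>0\<close> covers \<open>b \<in> A\<close>, where the distance vanishes although the coefficient may be
  negative: if \<open>theta4\<close> is infinite, \<open>\<gamma>\<close> can exceed \<open>1\<close>. The hypothesis \<open>reg\<close> says that \<open>\<theta>\<close> is a
  lower bound for the infimum defining \<open>theta4_local A B p \<rho>\<close>; in this form it is symmetric in the two
  sets, up to the order of the two distances.\<close>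

lemma infdist_le_of_regular_near:
  fixes A B :: "'a::{real_inner, complete_space} set"
  assumes "closed A" and \<sigma>: "0 \<le> \<sigma>" "\<sigma> < \<gamma>" "\<gamma> - \<sigma> \<le> \<tau>" "\<tau> \<le> 1" and "\<gamma> < \<theta>"
    and reg: "\<And>x y. \<lbrakk>x \<in> A - B; y \<in> B - A; x \<in> ball p \<rho>; y \<in> ball p \<rho>\<rbrakk> \<Longrightarrow>
        \<theta> \<le> max (infdist ((y - x) /\<^sub>R norm (x - y)) (frechet_normal_cone A x))
                (infdist ((x - y) /\<^sub>R norm (x - y)) (frechet_normal_cone B y))"
    and "a \<in> A" and b: "b \<in> inexact_proj \<tau> \<sigma> B a" and close: "dist a p + dist a b < \<rho>"
  shows "infdist b A \<le> max 0 (1 - \<gamma>\<^sup>2 + \<gamma> * \<sigma>) * dist a b"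
proof (rule ccontr)
  define \<kappa> where "\<kappa> = \<gamma> - \<sigma>"
  define \<omega> where "\<omega> = (\<theta> - \<gamma>) / 2"
  define r where "r = norm (a - b)"
  define m where "m = infdist b A"
  assume "\<not> infdist b A \<le> max 0 (1 - \<gamma>\<^sup>2 + \<gamma> * \<sigma>) * dist a b"
  moreover have "0 \<le> max 0 (1 - \<gamma>\<^sup>2 + \<gamma> * \<sigma>) * dist a b" by simp
  moreover have "(1 - \<gamma>\<^sup>2 + \<gamma> * \<sigma>) * dist a b \<le> max 0 (1 - \<gamma>\<^sup>2 + \<gamma> * \<sigma>) * dist a b"
    by (intro mult_right_mono) auto
  ultimately have "0 < m" "(1 - \<gamma>\<^sup>2 + \<gamma> * \<sigma>) * dist a b < m"
    unfolding m_def by linarith+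
  then have m: "0 < m" "(1 - \<gamma>\<^sup>2 + \<gamma> * \<sigma>) * r < m"
    by (simp_all add: r_def dist_norm)
  have \<kappa>: "0 < \<kappa>" "\<kappa> \<le> \<gamma>" "\<kappa> \<le> 1" "\<kappa> \<le> \<tau>" and "0 < \<gamma>" and \<omega>: "0 < \<omega>" "\<gamma> + \<omega> < \<theta>"
    using \<sigma> \<open>\<gamma> < \<theta>\<close> by (auto simp: \<kappa>_def \<omega>_def field_simps)
  have bB: "b \<in> B" "\<tau> * r \<le> infdist a B"
    "infdist (a - b) (frechet_normal_cone B b) \<le> \<sigma> * r"
    using b by (auto simp: inexact_proj_def r_def)
  have "b \<notin> A" using m(1) by (auto simp: m_def)
  have m_le: "m \<le> norm (x - b)" if "x \<in> A" for x
    using infdist_le[OF that, of b] by (simp add: m_def dist_norm norm_minus_commute)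
  have r: "0 < r" using m_le[OF \<open>a \<in> A\<close>] m(1) unfolding r_def by linarith
  \<comment> \<open>Positivity of the slack is the negated claim. It pays for the smoothing error in the bound
      \<open>norm (x - a) < \<kappa> * r\<close>; enlarging \<open>\<kappa>\<close> to \<open>\<kappa>'\<close> pays for it in the change of direction.\<close>
  define slack where "slack = \<gamma> * \<kappa> * r - (r - m)"
  have slack: "0 < slack"
    using m(2) by (simp add: slack_def \<kappa>_def power2_eq_square algebra_simps)
  define \<kappa>' where "\<kappa>' = \<kappa> + \<omega>"
  have \<kappa>': "0 < \<kappa>'" "\<kappa>\<^sup>2 < \<kappa>'\<^sup>2" using \<kappa> \<omega> by (auto simp: \<kappa>'_def intro!: power_strict_mono)
  define \<eta> where "\<eta> = min (slack / (2 * \<gamma>)) (min (\<kappa> * r) ((\<kappa>'\<^sup>2 - \<kappa>\<^sup>2) * m / (3 * \<kappa>)))"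
  have \<eta>: "0 < \<eta>" "\<gamma> * \<eta> < slack" "\<eta> \<le> \<kappa> * r" "3 * \<kappa> * \<eta> \<le> (\<kappa>'\<^sup>2 - \<kappa>\<^sup>2) * m"
  proof -
    show "0 < \<eta>" using slack \<kappa> \<kappa>' r m \<open>0 < \<gamma>\<close> by (simp add: \<eta>_def)
    have "\<eta> \<le> slack / (2 * \<gamma>)" by (simp add: \<eta>_def)
    then show "\<gamma> * \<eta> < slack" using slack \<open>0 < \<gamma>\<close> by (simp add: field_simps)
    show "\<eta> \<le> \<kappa> * r" by (simp add: \<eta>_def)
    have "\<eta> \<le> (\<kappa>'\<^sup>2 - \<kappa>\<^sup>2) * m / (3 * \<kappa>)" by (simp add: \<eta>_def)
    then show "3 * \<kappa> * \<eta> \<le> (\<kappa>'\<^sup>2 - \<kappa>\<^sup>2) * m" using \<kappa> by (simp add: field_simps)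
  qed
  obtain x where x: "x \<in> A" "norm (x - b) \<le> r"
    and pen: "norm (x - b) + \<gamma> * norm (x - a) \<le> r + \<gamma> * \<eta>"
    and normal_A: "infdist ((b - x) /\<^sub>R norm (x - b)) (frechet_normal_cone A x) \<le> \<gamma> + \<omega>"
    using obtain_penalised_minimum[OF \<open>closed A\<close> \<open>a \<in> A\<close> \<open>b \<notin> A\<close> \<open>0 < \<gamma>\<close> \<eta>(1) \<omega>(1)]
    unfolding r_def by blast
  have "\<gamma> * norm (x - a) < \<gamma> * (\<kappa> * r)"
    using pen m_le[OF x(1)] \<eta>(2) by (simp add: slack_def)
  then have T: "norm (x - a) < \<kappa> * r" using \<open>0 < \<gamma>\<close> by simp
  have "x \<notin> B"
  proof
    assume "x \<in> B"
    then have "\<tau> * r \<le> norm (x - a)"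
      using bB(2) infdist_le[of x B a] by (simp add: dist_norm norm_minus_commute)
    moreover have "\<kappa> * r \<le> \<tau> * r" using \<kappa> r by (intro mult_right_mono) auto
    ultimately show False using T by linarith
  qed
  moreover have "x \<in> ball p \<rho>" "b \<in> ball p \<rho>"
  proof -
    have "\<kappa> * r \<le> 1 * r" using \<kappa> r by (intro mult_right_mono) auto
    then have "dist x a < dist a b" using T by (simp add: r_def dist_norm)
    then show "x \<in> ball p \<rho>" using close dist_triangle[of x p a]
      by (simp add: dist_commute)
    show "b \<in> ball p \<rho>" using close dist_triangle[of b p a]
      by (simp add: dist_commute)
  qed
  ultimately have alt: "\<theta> \<le> max (infdist ((b - x) /\<^sub>R norm (x - b)) (frechet_normal_cone A x))
                (infdist ((x - b) /\<^sub>R norm (x - b)) (frechet_normal_cone B b))"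
    using x(1) bB(1) \<open>b \<notin> A\<close> by (intro reg) auto
  define u v where "u = (x - b) /\<^sub>R norm (x - b)" and "v = (a - b) /\<^sub>R norm (a - b)"
  have xb: "0 < norm (x - b)" using m_le[OF x(1)] m(1) by linarith
  have "infdist v (frechet_normal_cone B b) \<le> inverse r * infdist (a - b) (frechet_normal_cone B b)"
    unfolding v_def using infdist_frechet_normal_cone_scaleR_le[of "inverse r" "a - b" B b] r
    by (simp add: r_def)
  also have "\<dots> \<le> inverse r * (\<sigma> * r)" using bB(3) r by (intro mult_left_mono) auto
  also have "\<dots> = \<sigma>" using r by simp
  finally have v: "infdist v (frechet_normal_cone B b) \<le> \<sigma>" .
  have "(norm (u - v))\<^sup>2 * (norm (x - b) * r) = (norm (x - a))\<^sup>2 - (norm (x - b) - r)\<^sup>2"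
    unfolding u_def v_def r_def
    using direction_change_square[of "x - b" "a - b"] xb r by (simp add: r_def)
  also have "\<dots> \<le> \<kappa>\<^sup>2 * (r * norm (x - b)) + (2 * \<eta> * \<kappa> * r + \<eta>\<^sup>2)"
    using penalised_step_bound[of \<kappa> \<gamma> \<eta> "norm (x - a)" "norm (x - b)" r] \<kappa> \<eta>(1) T pen x(2) r
    by (simp add: power2_commute)
  also have "2 * \<eta> * \<kappa> * r + \<eta>\<^sup>2 \<le> (3 * \<kappa> * \<eta>) * r"
    using mult_left_mono[OF \<eta>(3), of \<eta>] \<eta>(1) by (simp add: power2_eq_square algebra_simps)
  also have "\<dots> \<le> ((\<kappa>'\<^sup>2 - \<kappa>\<^sup>2) * m) * r" using \<eta>(4) r by (intro mult_right_mono) auto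
  also have "\<dots> \<le> ((\<kappa>'\<^sup>2 - \<kappa>\<^sup>2) * norm (x - b)) * r"
    using \<kappa>'(2) m_le[OF x(1)] r by (intro mult_right_mono mult_left_mono) auto
  finally have "(norm (u - v))\<^sup>2 * (norm (x - b) * r) \<le> \<kappa>'\<^sup>2 * (norm (x - b) * r)"
    by (simp add: algebra_simps)
  then have "(norm (u - v))\<^sup>2 \<le> \<kappa>'\<^sup>2" using xb r by simp
  then have "norm (u - v) \<le> \<kappa>'" by (rule power2_le_imp_le) (use \<kappa>' in simp)
  then have "infdist u (frechet_normal_cone B b) \<le> \<sigma> + \<kappa>'"
    using infdist_triangle[of u "frechet_normal_cone B b" v] v by (simp add: dist_norm)
  also have "\<dots> = \<gamma> + \<omega>" by (simp add: \<kappa>'_def \<kappa>_def)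
  finally show False
    using alt normal_A \<omega>(2) unfolding u_def by linarith
qed

section \<open>Convergence of alternating projections\<close>

lemma inexact_proj_contraction:
  assumes c: "c = inverse \<tau> * (1 - \<gamma>\<^sup>2 + \<gamma> * \<sigma>)" and "0 < \<tau>"
    and "infdist b A \<le> max 0 (1 - \<gamma>\<^sup>2 + \<gamma> * \<sigma>) * dist a b" and "a' \<in> inexact_proj \<tau> \<sigma> A b"
  shows "dist b a' \<le> max 0 c * dist a b"
proof -
  have "\<tau> * dist b a' \<le> max 0 (1 - \<gamma>\<^sup>2 + \<gamma> * \<sigma>) * dist a b"
    using assms(3,4) by (auto simp: inexact_proj_def dist_norm)
  also have "max 0 (1 - \<gamma>\<^sup>2 + \<gamma> * \<sigma>) = \<tau> * max 0 c"
    using \<open>0 < \<tau>\<close> by (auto simp: c max_def zero_le_mult_iff field_simps)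
  finally show ?thesis using \<open>0 < \<tau>\<close> by (simp add: mult.assoc)
qed

(* The guard 0 < c in the conclusion is automatic when theta4 A B xb is finite, since then
   theta4 A B xb \<le> 1 and hence \<gamma> < 1.  When theta4 A B xb = \<infinity>, nothing bounds \<gamma> by 1 and c may be
   nonpositive; the sequence still converges, but C * c ^ n is not a meaningful bound. *)
theorem theorem31:
  fixes A B :: "'a::{real_inner, complete_space} set"
    and xb :: 'a and \<sigma> \<tau> \<gamma> c :: real
  assumes "closed A" and "closed B" and "xb \<in> A \<inter> B"
    and "DIL_restrictedly_regular A B xb"
    and "0 \<le> \<sigma>" and "ereal \<sigma> < theta4 A B xb" and "\<sigma> < 1"
    and "0 < \<tau>" and "\<tau> \<le> 1"
    and "ereal \<gamma> < theta4 A B xb" and "0 < \<gamma> - \<sigma>" and "\<gamma> - \<sigma> \<le> \<tau>"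
    and "c = inverse \<tau> * (1 - \<gamma>\<^sup>2 + \<gamma> * \<sigma>)" and "c < 1"
  shows "\<exists>\<delta>>0. \<forall>x. alternating_projections \<tau> \<sigma> A B x \<and> x 0 \<in> ball xb \<delta> \<longrightarrow>
           (\<exists>xs\<in>A \<inter> B. x \<longlonglongrightarrow> xs \<and> (0 < c \<longrightarrow> R_linear_rate x xs c))"
proof -
  obtain \<theta> where \<theta>: "\<gamma> < \<theta>" "ereal \<theta> < theta4 A B xb"
    using ereal_dense2[OF \<open>ereal \<gamma> < theta4 A B xb\<close>] by auto
  have "\<forall>\<^sub>F \<rho> in at_right 0. ereal \<theta> < theta4_local A B xb \<rho>"
    using order_tendstoD(1)[OF theta4_local_tendsto \<theta>(2)] .
  moreover have "\<forall>\<^sub>F \<rho> in at_right (0::real). 0 < \<rho>"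
    by (rule eventually_at_right_less)
  ultimately obtain \<rho> where \<rho>: "0 < \<rho>" "ereal \<theta> < theta4_local A B xb \<rho>"
    using eventually_happens[OF eventually_conj] by (metis trivial_limit_at_right_real)
  have reg: "\<theta> \<le> max (infdist ((y - x) /\<^sub>R norm (x - y)) (frechet_normal_cone A x))
                     (infdist ((x - y) /\<^sub>R norm (x - y)) (frechet_normal_cone B y))"
    if "x \<in> A - B" "y \<in> B - A" "x \<in> ball xb \<rho>" "y \<in> ball xb \<rho>" for x y
  proof -
    have "theta4_local A B xb \<rho> \<le>
        ereal (max (infdist ((y - x) /\<^sub>R norm (x - y)) (frechet_normal_cone A x))
                   (infdist ((x - y) /\<^sub>R norm (x - y)) (frechet_normal_cone B y)))"
      unfolding theta4_local_def using that by (intro INF_lower2[of "(x, y)"]) auto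
    from less_le_trans[OF \<rho>(2) this] show ?thesis
      unfolding less_ereal.simps by (rule less_imp_le)
  qed
  \<comment> \<open>A contraction factor has to be nonnegative, and \<open>c\<close> need not be.\<close>
  define q where "q = max 0 c"
  have q: "0 \<le> q" "q < 1" using \<open>c < 1\<close> by (auto simp: q_def)
  have \<sigma>\<gamma>: "\<sigma> < \<gamma>" using \<open>0 < \<gamma> - \<sigma>\<close> by simp
  have step_A: "dist b a' \<le> q * dist a b"
    if "a \<in> A" "b \<in> inexact_proj \<tau> \<sigma> B a" "a' \<in> inexact_proj \<tau> \<sigma> A b" "dist a xb + dist a b < \<rho>"
    for a b a'
    unfolding q_def
    by (rule inexact_proj_contraction[OF assms(13,8) _ that(3)],
        rule infdist_le_of_regular_near[OF \<open>closed A\<close> \<open>0 \<le> \<sigma>\<close> \<sigma>\<gamma> assms(12,9) \<theta>(1) reg that(1,2,4)])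
  have step_B: "dist b a' \<le> q * dist a b"
    if "a \<in> B" "b \<in> inexact_proj \<tau> \<sigma> A a" "a' \<in> inexact_proj \<tau> \<sigma> B b" "dist a xb + dist a b < \<rho>"
    for a b a'
    unfolding q_def
  proof (rule inexact_proj_contraction[OF assms(13,8) _ that(3)],
      rule infdist_le_of_regular_near[OF \<open>closed B\<close> \<open>0 \<le> \<sigma>\<close> \<sigma>\<gamma> assms(12,9) \<theta>(1) _ that(1,2,4)])
    fix x y assume "x \<in> B - A" "y \<in> A - B" "x \<in> ball xb \<rho>" "y \<in> ball xb \<rho>"
    then show "\<theta> \<le> max (infdist ((y - x) /\<^sub>R norm (x - y)) (frechet_normal_cone B x))
                     (infdist ((x - y) /\<^sub>R norm (x - y)) (frechet_normal_cone A y))"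
      using reg[of y x] by (simp add: max.commute norm_minus_commute)
  qed
  \<comment> \<open>The initial point may lie outside both sets. The first two inexact projections lose a factor of
      at most \<open>\<tau>\<^sup>-\<^sup>1\<close> each, and the contraction starts at \<open>x 1\<close>; hence \<open>\<tau>\<^sup>2\<close> and the shifted sequence \<open>y\<close>.\<close>
  define \<delta> where "\<delta> = \<rho> * \<tau>\<^sup>2 * (1 - q) / 4"
  have "0 < \<delta>" using \<rho> q \<open>0 < \<tau>\<close> by (simp add: \<delta>_def)
  moreover have "\<exists>xs\<in>A \<inter> B. x \<longlonglongrightarrow> xs \<and> (0 < c \<longrightarrow> R_linear_rate x xs c)"
    if x: "alternating_projections \<tau> \<sigma> A B x" and x0: "x 0 \<in> ball xb \<delta>" for x
  proof -
    have odd_proj: "x (2 * n + 1) \<in> inexact_proj \<tau> \<sigma> B (x (2 * n))"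
      and even_proj: "x (2 * n + 2) \<in> inexact_proj \<tau> \<sigma> A (x (2 * n + 1))" for n
      using x by (auto simp: alternating_projections_def)
    have in_B: "x (2 * n + 1) \<in> B" and in_A: "x (2 * n + 2) \<in> A" for n
      using odd_proj[of n] even_proj[of n] by (auto simp: inexact_proj_def)
    have proj_dist: "\<tau> * dist z y \<le> dist z xb" if "y \<in> inexact_proj \<tau> \<sigma> C z" "xb \<in> C" for z y C
      using that infdist_le[of xb C z] by (auto simp: inexact_proj_def dist_norm)
    define y where "y n = x (Suc n)" for n
    have start: "dist (y 0) xb + dist (y 0) (y 1) / (1 - q) < \<rho>"
    proof -
      define d where "d = dist (x 0) xb"
      have d: "0 \<le> d" "d < \<delta>" using x0 by (auto simp: d_def dist_commute)
      have "\<tau> * dist (x 0) (x 1) \<le> d"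
        using proj_dist[OF odd_proj[of 0]] \<open>xb \<in> A \<inter> B\<close> by (simp add: d_def)
      moreover have "\<tau> * dist (y 0) xb \<le> \<tau> * (dist (x 0) (x 1) + d)"
        using dist_triangle[of "x 1" xb "x 0"] \<open>0 < \<tau>\<close>
        by (intro mult_left_mono) (auto simp: y_def d_def dist_commute)
      moreover have "\<tau> * d \<le> 1 * d" using d \<open>\<tau> \<le> 1\<close> by (intro mult_right_mono) auto
      ultimately have y0: "\<tau> * dist (y 0) xb \<le> 2 * d" by (simp add: algebra_simps)
      have "\<tau> * dist (y 0) (y 1) \<le> dist (y 0) xb"
        using proj_dist[OF even_proj[of 0]] \<open>xb \<in> A \<inter> B\<close> by (simp add: y_def numeral_2_eq_2)
      then have "\<tau> * (\<tau> * dist (y 0) (y 1)) \<le> \<tau> * dist (y 0) xb"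
        using \<open>0 < \<tau>\<close> by (intro mult_left_mono) auto
      with y0 have y1: "\<tau>\<^sup>2 * dist (y 0) (y 1) \<le> 2 * d" by (simp add: power2_eq_square)
      have "\<tau> * (1 - q) \<le> 1"
        using q \<open>0 < \<tau>\<close> \<open>\<tau> \<le> 1\<close> by (intro mult_le_one) auto
      from mult_mono[OF this y0] have "\<tau> * (1 - q) * (\<tau> * dist (y 0) xb) \<le> 2 * d"
        using \<open>0 < \<tau>\<close> by simp
      then have "\<tau>\<^sup>2 * (1 - q) * dist (y 0) xb + \<tau>\<^sup>2 * dist (y 0) (y 1) \<le> 4 * d"
        using y1 by (simp add: power2_eq_square algebra_simps)
      also have "\<dots> < 4 * \<delta>" using d by simp
      also have "4 * \<delta> = \<tau>\<^sup>2 * (1 - q) * \<rho>" by (simp add: \<delta>_def)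
      finally have "\<tau>\<^sup>2 * (1 - q) * (dist (y 0) xb + dist (y 0) (y 1) / (1 - q)) < \<tau>\<^sup>2 * (1 - q) * \<rho>"
        using q by (simp add: distrib_left)
      then show ?thesis using q \<open>0 < \<tau>\<close> by simp
    qed
    have contr: "dist (y (Suc n)) (y (Suc (Suc n))) \<le> q * dist (y n) (y (Suc n))"
      if "dist (y n) xb + dist (y n) (y (Suc n)) < \<rho>" for n
    proof (cases "even n")
      case True
      then obtain k where "n = 2 * k" by (rule evenE)
      with that show ?thesis
        using step_B[OF in_B[of k] even_proj[of k], of "x (2 * Suc k + 1)"] odd_proj[of "Suc k"]
        by (simp add: y_def)
    next
      case False
      then obtain k where "n = 2 * k + 1" by (rule oddE)
      with that show ?thesis
        using step_A[OF in_A[of k], of "x (2 * Suc k + 1)" "x (2 * Suc k + 2)"]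
          odd_proj[of "Suc k"] even_proj[of "Suc k"]
        by (simp add: y_def)
    qed
    obtain l where l: "y \<longlonglongrightarrow> l"
      and rate: "\<And>n. dist (y n) l \<le> dist (y 0) (y 1) / (1 - q) * q ^ n"
      using convergent_of_local_contraction[OF q start contr] by blast
    have x_lim: "x \<longlonglongrightarrow> l" using l unfolding y_def by (simp add: filterlim_sequentially_Suc)
    have "l \<in> B"
    proof (rule closed_sequentially[OF \<open>closed B\<close>])
      show "(\<lambda>n. x (2 * n + 1)) \<longlonglongrightarrow> l"
        using LIMSEQ_subseq_LIMSEQ[OF x_lim, of "\<lambda>n. 2 * n + 1"] by (simp add: strict_mono_def o_def)
    qed (fact in_B)
    moreover have "l \<in> A"
    proof (rule closed_sequentially[OF \<open>closed A\<close>])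
      show "(\<lambda>n. x (2 * n + 2)) \<longlonglongrightarrow> l"
        using LIMSEQ_subseq_LIMSEQ[OF x_lim, of "\<lambda>n. 2 * n + 2"] by (simp add: strict_mono_def o_def)
    qed (fact in_A)
    moreover have "R_linear_rate x l c" if "0 < c"
    proof -
      have "q = c" using that by (simp add: q_def)
      define C where "C = dist (y 0) (y 1) / (1 - c) / c"
      have "norm (x n - l) \<le> max C (dist (x 0) l) * c ^ n" for n
      proof (cases n)
        case 0
        then show ?thesis by (simp add: dist_norm)
      next
        case (Suc k)
        have "norm (x n - l) \<le> C * c ^ n"
          using rate[of k] that Suc \<open>q = c\<close> by (simp add: y_def C_def dist_norm)
        also have "\<dots> \<le> max C (dist (x 0) l) * c ^ n"
          using that by (intro mult_right_mono) auto
        finally show ?thesis .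
      qed
      moreover have "0 \<le> max C (dist (x 0) l)" by (simp add: le_max_iff_disj)
      ultimately show ?thesis unfolding R_linear_rate_def by blast
    qed
    ultimately show ?thesis using x_lim by blast
  qed
  ultimately show ?thesis by blast
qed

end
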